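(* Let $P$ be a polygon in the plane of nonzero signed area, and let $E$ be its generalized Euler line. 1. If $P$ has a line of reflection symmetry $L$, then $E$ is either $L$ or a point on $L$. 2. If $P$ has a center $C$ of (nontrivial) rotational symmetry and none of the extensions of sides of $P$ pass through $C$, then $E=\{C\}$. 3. Assume that the sides $S_1,S_2,\dots,S_n$ of $P$ satisfy $|S_1|=|S_2|=\dots=|S_{n-1}|$. Then $E$ is orthogonal to the side $S_n$.
   Context: A polygon $P=(V_1,\dots,V_n)$, $n\ge 3$, is a closed oriented polygon in $\mathbb{R}^2$ given by the cyclic sequence of its vertices (indices mod $n$), consecutive vertices being distinct. With $V_i=(x_i,y_i)$ the signed area is $A(P)=\tfrac12\sum_i (x_iy_{i+1}-x_{i+1}y_i)$. A symmetry of $P$ is an isometry mapping $P$ to itself as a polygon (i.e. preserving its cyclic sequence of vertices up to cyclic shift and reversal). For $A(P)\neq0$ let $O$ be any point not on the sides of $P$ or their extensions and let $A_i=\tfrac12\det(V_i-O,V_{i+1}-O)$. Then $CCM(P)=\sum_i\frac{A_i}{A(P)}C_i$, where $C_i$ is the circumcenter of the triangle $OV_iV_{i+1}$, and $CM(P)=\sum_i\frac{A_i}{A(P)}G_i$, where $G_i$ is the centroid of $OV_iV_{i+1}$; neither depends on $O$. The generalized Euler line of $P$ is $$E=\{\,t\,CM(P)+(1-t)\,CCM(P): t\in\mathbb{R}\,\},$$ which is a line, or a single point if $CM(P)=CCM(P)$. "$E$ is orthogonal to $S_n$" means that the vector $CM(P)-CCM(P)$ is orthogonal to $S_n$ (so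 it holds vacuously when $E$ is a point). *)

theory Defs
  imports "HOL-Analysis.Analysis"
begin

text \<open>
  A polygon is given by one listing of its cyclic vertex sequence; \<open>vtx P\<close> reads
  the list with indices modulo its length, so that \<open>side P i\<close> is the oriented side from
  vertex \<open>i\<close> to vertex \<open>i + 1\<close>, and \<open>side P (length P - 1)\<close> runs from
  the last vertex back to the first. Non-adjacent vertices may coincide and sides may cross.
\<close>

definition vtx :: "(real^2) list \<Rightarrow> nat \<Rightarrow> real^2" where
  "vtx P i = P ! (i mod length P)"

definition side :: "(real^2) list \<Rightarrow> nat \<Rightarrow> real^2" where
  "side P i = vtx P (Suc i) - vtx P i"

definition side_line :: "(real^2) list \<Rightarrow> nat \<Rightarrow> (real^2) set" where
  "side_line P i = affine hull {vtx P i, vtx P (Suc i)}"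

definition polygon :: "(real^2) list \<Rightarrow> bool" where
  "polygon P \<longleftrightarrow> length P \<ge> 3 \<and> (\<forall>i < length P. vtx P i \<noteq> vtx P (Suc i))"

definition signed_area :: "(real^2) list \<Rightarrow> real" where
  "signed_area P =
     1/2 * (\<Sum>i<length P. vtx P i $ 1 * vtx P (Suc i) $ 2 - vtx P (Suc i) $ 1 * vtx P i $ 2)"

text \<open>
  An isometry of the plane maps \<open>P\<close> to itself as a polygon if it preserves the vertex
  sequence up to cyclic shift and reversal.
\<close>

definition polygon_symmetry :: "(real^2 \<Rightarrow> real^2) \<Rightarrow> (real^2) list \<Rightarrow> bool" where
  "polygon_symmetry f P \<longleftrightarrow>
     (\<forall>x y. dist (f x) (f y) = dist x y) \<and>
     (\<exists>k. map f P = rotate k P \<or> map f P = rotate k (rev P))"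

text \<open>Since \<open>closest_point L\<close> is the orthogonal projection onto the line \<open>L\<close>,
  the following is the reflection across \<open>L\<close>.\<close>

definition reflection_across :: "(real^2) set \<Rightarrow> real^2 \<Rightarrow> real^2" where
  "reflection_across L x = 2 *\<^sub>R closest_point L x - x"

definition reflection_line :: "(real^2) list \<Rightarrow> (real^2) set \<Rightarrow> bool" where
  "reflection_line P L \<longleftrightarrow>
     affine L \<and> aff_dim L = 1 \<and> polygon_symmetry (reflection_across L) P"

definition rotation_about :: "real^2 \<Rightarrow> real^2^2 \<Rightarrow> real^2 \<Rightarrow> real^2" where
  "rotation_about C R x = C + R *v (x - C)"

definition rotation_center :: "(real^2) list \<Rightarrow> real^2 \<Rightarrow> bool" where
  "rotation_center P C \<longleftrightarrow>
     (\<exists>R. rotation_matrix R \<and> R \<noteq> mat 1 \<and> polygon_symmetry (rotation_about C R) P)"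

definition circumcenter :: "real^2 \<Rightarrow> real^2 \<Rightarrow> real^2 \<Rightarrow> real^2" where
  "circumcenter a b c = (THE x. dist x a = dist x b \<and> dist x b = dist x c)"

definition centroid :: "real^2 \<Rightarrow> real^2 \<Rightarrow> real^2 \<Rightarrow> real^2" where
  "centroid a b c = (1/3) *\<^sub>R (a + b + c)"

definition off_sides :: "(real^2) list \<Rightarrow> real^2 \<Rightarrow> bool" where
  "off_sides P z \<longleftrightarrow> (\<forall>i < length P. z \<notin> side_line P i)"

definition tri_area :: "(real^2) list \<Rightarrow> real^2 \<Rightarrow> nat \<Rightarrow> real" where
  "tri_area P z i = 1/2 * det (vector [vtx P i - z, vtx P (Suc i) - z] :: real^2^2)"

definition CCM_at :: "(real^2) list \<Rightarrow> real^2 \<Rightarrow> real^2" where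
  "CCM_at P z = (\<Sum>i<length P.
     (tri_area P z i / signed_area P) *\<^sub>R circumcenter z (vtx P i) (vtx P (Suc i)))"

definition CM_at :: "(real^2) list \<Rightarrow> real^2 \<Rightarrow> real^2" where
  "CM_at P z = (\<Sum>i<length P.
     (tri_area P z i / signed_area P) *\<^sub>R centroid z (vtx P i) (vtx P (Suc i)))"

text \<open>The common value of \<open>CCM_at P z\<close>, resp. \<open>CM_at P z\<close>, over all admissible base
  points; lemmas \<open>CCM_eq\<close> and \<open>CM_eq\<close> below show that it exists.\<close>

definition CCM :: "(real^2) list \<Rightarrow> real^2" where
  "CCM P = (THE X. \<forall>z. off_sides P z \<longrightarrow> CCM_at P z = X)"

definition CM :: "(real^2) list \<Rightarrow> real^2" where
  "CM P = (THE X. \<forall>z. off_sides P z \<longrightarrow> CM_at P z = X)"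

definition euler_line :: "(real^2) list \<Rightarrow> (real^2) set" where
  "euler_line P = {t *\<^sub>R CM P + (1 - t) *\<^sub>R CCM P | t. True}"

subsection \<open>Independence of the base point\<close>

lemma ex_off_sides: "\<exists>z. off_sides P z"
proof -
  have "negligible (side_line P i)" for i
  proof -
    have "aff_dim (side_line P i) \<le> 1"
      unfolding side_line_def aff_dim_affine_hull2[symmetric]
      by (simp add: aff_dim_2)
    hence "interior (side_line P i) = {}"
      using aff_dim_nonempty_interior[of "side_line P i"] by fastforce
    moreover have "closed (side_line P i)" "convex (side_line P i)"
      by (simp_all add: side_line_def affine_imp_convex)
    ultimately show ?thesis
      using negligible_convex_interior by blast
  qed
  hence "negligible (\<Union>i<length P. side_line P i)"
    by (intro negligible_Union) auto
  hence "(\<Union>i<length P. side_line P i) \<noteq> UNIV"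
    using non_negligible_UNIV by metis
  thus ?thesis by (auto simp: off_sides_def)
qed

lemma sum_cyclic_telescope:
  fixes h :: "real^2 \<Rightarrow> 'a::ab_group_add"
  shows "(\<Sum>i<length P. h (vtx P (Suc i)) - h (vtx P i)) = 0"
  using sum_lessThan_telescope[of "\<lambda>i. h (vtx P i)" "length P"] by (simp add: vtx_def)

lemma sum_modulo_telescope:
  fixes h :: "real^2 \<Rightarrow> 'a::real_vector"
  assumes "\<And>i. i < length P \<Longrightarrow> f i = c *\<^sub>R a i + (h (vtx P (Suc i)) - h (vtx P i))"
  shows "(\<Sum>i<length P. f i) = c *\<^sub>R (\<Sum>i<length P. a i)"
  using assms by (simp add: sum.distrib sum_cyclic_telescope scaleR_sum_right)

lemma vec2_eq_iff: "(x::real^2) = y \<longleftrightarrow> x$1 = y$1 \<and> x$2 = y$2"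
  by (simp add: vec_eq_iff forall_2)

lemma det_zero_imp_affine_hull:
  fixes a b z :: "real^2"
  assumes "a \<noteq> b" "(a$1 - z$1) * (b$2 - z$2) = (a$2 - z$2) * (b$1 - z$1)"
  shows "z \<in> affine hull {a, b}"
proof -
  have "\<exists>u v. z = u *\<^sub>R a + v *\<^sub>R b \<and> u + v = 1"
  proof (cases "a$1 = b$1")
    case False
    define v where "v = (z$1 - a$1) / (b$1 - a$1)"
    have "z$1 = (1-v) * a$1 + v * b$1" "z$2 = (1-v) * a$2 + v * b$2"
      using False assms(2) unfolding v_def by (simp_all add: divide_simps) (simp_all add: algebra_simps)
    thus ?thesis by (intro exI[of _ "1-v"] exI[of _ v]) (simp add: vec2_eq_iff)
  next
    case True
    hence ne: "a$2 \<noteq> b$2" using assms(1) by (simp add: vec2_eq_iff)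
    define v where "v = (z$2 - a$2) / (b$2 - a$2)"
    have "z$1 = (1-v) * a$1 + v * b$1" "z$2 = (1-v) * a$2 + v * b$2"
      using ne True assms(2) unfolding v_def by (simp_all add: divide_simps) (simp_all add: algebra_simps)
    thus ?thesis by (intro exI[of _ "1-v"] exI[of _ v]) (simp add: vec2_eq_iff)
  qed
  thus ?thesis by (auto simp: affine_hull_2)
qed

lemma tri_area_altdef:
  "tri_area P z i = ((vtx P i $ 1 - z$1) * (vtx P (Suc i) $ 2 - z$2)
     - (vtx P i $ 2 - z$2) * (vtx P (Suc i) $ 1 - z$1)) / 2"
  by (simp add: tri_area_def det_2)

lemma tri_area_nonzero:
  assumes "polygon P" "off_sides P z" "i < length P"
  shows "tri_area P z i \<noteq> 0"
  using assms det_zero_imp_affine_hull[of "vtx P i" "vtx P (Suc i)" z]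
  by (auto simp: tri_area_altdef polygon_def off_sides_def side_line_def)

lemma dist_vec2_eq_iff:
  fixes x a b :: "real^2"
  shows "dist x a = dist x b \<longleftrightarrow>
    (x$1 - a$1)^2 + (x$2 - a$2)^2 = (x$1 - b$1)^2 + (x$2 - b$2)^2"
  by (simp add: dist_vec_def L2_set_def sum_2 dist_real_def)

lemma circumcenter_eq:
  fixes a b c :: "real^2"
  defines "D \<equiv> (b$1 - a$1) * (c$2 - a$2) - (b$2 - a$2) * (c$1 - a$1)"
  defines "p \<equiv> (b$1 - a$1)^2 + (b$2 - a$2)^2"
  defines "q \<equiv> (c$1 - a$1)^2 + (c$2 - a$2)^2"
  assumes "D \<noteq> 0"
  shows "circumcenter a b c = a + (1/(2*D)) *\<^sub>R
    vector [(c$2 - a$2) * p - (b$2 - a$2) * q, (b$1 - a$1) * q - (c$1 - a$1) * p]" (is "_ = ?X")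
proof -
  have lin: "dist x a = dist x b \<and> dist x b = dist x c \<longleftrightarrow>
      2 * ((x$1 - a$1) * (b$1 - a$1) + (x$2 - a$2) * (b$2 - a$2)) = p \<and>
      2 * ((x$1 - a$1) * (c$1 - a$1) + (x$2 - a$2) * (c$2 - a$2)) = q" for x :: "real^2"
  proof -
    have "dist x a = dist x b \<and> dist x b = dist x c \<longleftrightarrow> dist x a = dist x b \<and> dist x a = dist x c"
      by auto
    thus ?thesis
      unfolding dist_vec2_eq_iff p_def q_def power2_eq_square by (auto simp: algebra_simps)
  qed
  have cramer: "2 * (u * (b$1 - a$1) + v * (b$2 - a$2)) = p \<and>
      2 * (u * (c$1 - a$1) + v * (c$2 - a$2)) = q \<longleftrightarrow>
      u = ((c$2 - a$2) * p - (b$2 - a$2) * q) / (2*D) \<and>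
      v = ((b$1 - a$1) * q - (c$1 - a$1) * p) / (2*D)" (is "?l \<longleftrightarrow> ?r") for u v
  proof
    assume l: ?l
    have "2 * D * u = (c$2 - a$2) * p - (b$2 - a$2) * q"
         "2 * D * v = (b$1 - a$1) * q - (c$1 - a$1) * p"
      unfolding l[THEN conjunct1, symmetric] l[THEN conjunct2, symmetric] D_def by algebra+
    thus ?r using \<open>D \<noteq> 0\<close> by (simp add: field_simps)
  next
    assume r: ?r
    hence e: "2 * D * u = (c$2 - a$2) * p - (b$2 - a$2) * q"
         "2 * D * v = (b$1 - a$1) * q - (c$1 - a$1) * p" using \<open>D \<noteq> 0\<close> by auto
    have "D * (2 * (u * (b$1 - a$1) + v * (b$2 - a$2))) = D * p"
         "D * (2 * (u * (c$1 - a$1) + v * (c$2 - a$2))) = D * q"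
      using e unfolding D_def by algebra+
    thus ?l using \<open>D \<noteq> 0\<close> by simp
  qed
  have "dist x a = dist x b \<and> dist x b = dist x c \<longleftrightarrow> x = ?X" for x :: "real^2"
    unfolding lin cramer by (auto simp: vec2_eq_iff)
  thus ?thesis unfolding circumcenter_def by simp
qed

lemma tri_area_circumcenter:
  assumes "tri_area P z i \<noteq> 0"
  defines "v \<equiv> vtx P i" and "w \<equiv> vtx P (Suc i)"
  defines "g \<equiv> \<lambda>x::real^2. (1/4) *\<^sub>R (vector
      [2 * z$1 * (z$2 * x$1 - z$1 * x$2) + (z$1^2 + z$2^2) * x$2 + z$2 * (x$1^2 + x$2^2)
         - 2 * z$2 * (x$1 * z$1 + x$2 * z$2),
       2 * z$2 * (z$2 * x$1 - z$1 * x$2) - (z$1^2 + z$2^2) * x$1 - z$1 * (x$1^2 + x$2^2)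
         + 2 * z$1 * (x$1 * z$1 + x$2 * z$2)] :: real^2)"
  shows "tri_area P z i *\<^sub>R circumcenter z v w =
    (1/4) *\<^sub>R vector [w$2 * (v$1^2 + v$2^2) - v$2 * (w$1^2 + w$2^2),
                     v$1 * (w$1^2 + w$2^2) - w$1 * (v$1^2 + v$2^2)] + (g w - g v)"
proof -
  define D where "D = (v$1 - z$1) * (w$2 - z$2) - (v$2 - z$2) * (w$1 - z$1)"
  have T: "tri_area P z i = D / 2" by (simp add: tri_area_altdef D_def v_def w_def)
  have "D \<noteq> 0" using assms(1) T by simp
  hence C: "circumcenter z v w = z + (1/(2*D)) *\<^sub>R
    vector [(w$2 - z$2) * ((v$1 - z$1)^2 + (v$2 - z$2)^2) - (v$2 - z$2) * ((w$1 - z$1)^2 + (w$2 - z$2)^2),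
            (v$1 - z$1) * ((w$1 - z$1)^2 + (w$2 - z$2)^2) - (w$1 - z$1) * ((v$1 - z$1)^2 + (v$2 - z$2)^2)]"
    unfolding D_def by (rule circumcenter_eq)
  have "(D/2) *\<^sub>R circumcenter z v w = (D/2) *\<^sub>R z + (1/4) *\<^sub>R
    vector [(w$2 - z$2) * ((v$1 - z$1)^2 + (v$2 - z$2)^2) - (v$2 - z$2) * ((w$1 - z$1)^2 + (w$2 - z$2)^2),
            (v$1 - z$1) * ((w$1 - z$1)^2 + (w$2 - z$2)^2) - (w$1 - z$1) * ((v$1 - z$1)^2 + (v$2 - z$2)^2)]"
    unfolding C using \<open>D \<noteq> 0\<close> by (simp add: scaleR_add_right)
  thus ?thesis unfolding T
    by (simp add: vec2_eq_iff g_def D_def) (simp add: field_simps power2_eq_square)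
qed

lemma CCM_at_altdef:
  assumes "polygon P" "off_sides P z"
  shows "CCM_at P z = (1 / (4 * signed_area P)) *\<^sub>R (\<Sum>i<length P. let v = vtx P i; w = vtx P (Suc i) in
    vector [w$2 * (v$1^2 + v$2^2) - v$2 * (w$1^2 + w$2^2),
            v$1 * (w$1^2 + w$2^2) - w$1 * (v$1^2 + v$2^2)])"
proof -
  have "CCM_at P z = (1 / signed_area P) *\<^sub>R
      (\<Sum>i<length P. tri_area P z i *\<^sub>R circumcenter z (vtx P i) (vtx P (Suc i)))"
    by (simp add: CCM_at_def scaleR_sum_right)
  also have "(\<Sum>i<length P. tri_area P z i *\<^sub>R circumcenter z (vtx P i) (vtx P (Suc i))) =
    (1/4) *\<^sub>R (\<Sum>i<length P. let v = vtx P i; w = vtx P (Suc i) in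
    vector [w$2 * (v$1^2 + v$2^2) - v$2 * (w$1^2 + w$2^2),
            v$1 * (w$1^2 + w$2^2) - w$1 * (v$1^2 + v$2^2)])"
    unfolding Let_def
    by (rule sum_modulo_telescope, rule tri_area_circumcenter, rule tri_area_nonzero[OF assms])
  finally show ?thesis by simp
qed

lemma CM_at_altdef:
  "CM_at P z = (1 / (6 * signed_area P)) *\<^sub>R (\<Sum>i<length P. let v = vtx P i; w = vtx P (Suc i) in
    (v$1 * w$2 - v$2 * w$1) *\<^sub>R (v + w))"
proof -
  define g where "g = (\<lambda>x::real^2. (1/6) *\<^sub>R (vector
     [x$1 * (x$1 * z$2 - x$2 * z$1) + z$1 * (z$2 * x$1 - z$1 * x$2),
      x$2 * (x$1 * z$2 - x$2 * z$1) + z$2 * (z$2 * x$1 - z$1 * x$2)] :: real^2))"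
  have *: "tri_area P z i *\<^sub>R centroid z (vtx P i) (vtx P (Suc i)) =
     (1/6) *\<^sub>R ((vtx P i $ 1 * vtx P (Suc i) $ 2 - vtx P i $ 2 * vtx P (Suc i) $ 1) *\<^sub>R
       (vtx P i + vtx P (Suc i))) + (g (vtx P (Suc i)) - g (vtx P i))" for i
    by (simp add: vec2_eq_iff g_def tri_area_altdef centroid_def) (simp add: field_simps)
  have "CM_at P z = (1 / signed_area P) *\<^sub>R
      (\<Sum>i<length P. tri_area P z i *\<^sub>R centroid z (vtx P i) (vtx P (Suc i)))"
    by (simp add: CM_at_def scaleR_sum_right)
  also have "(\<Sum>i<length P. tri_area P z i *\<^sub>R centroid z (vtx P i) (vtx P (Suc i))) =
    (1/6) *\<^sub>R (\<Sum>i<length P. let v = vtx P i; w = vtx P (Suc i) in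
    (v$1 * w$2 - v$2 * w$1) *\<^sub>R (v + w))"
    unfolding Let_def by (rule sum_modulo_telescope, rule *)
  finally show ?thesis by simp
qed

lemma CCM_eq:
  assumes "polygon P" "off_sides P z"
  shows "CCM P = CCM_at P z"
  unfolding CCM_def using assms by (intro the_equality) (auto simp: CCM_at_altdef)

lemma CM_eq:
  assumes "off_sides P z"
  shows "CM P = CM_at P z"
  unfolding CM_def using assms by (intro the_equality) (auto simp: CM_at_altdef)

end

theory Submission
  imports Defs
begin

text \<open>
  Let \<open>J\<close> be the rotation by a right angle. Up to terms that cancel in the cyclic sum, twelve
  times the area-weighted difference of centroid and circumcenter of the triangle spanned by the
  base point and a side \<open>s\<close> is \<open>|s|\<^sup>2 J s\<close>, so
  \<open>12 A(P) (CM(P) - CCM(P)) = \<Sum>\<^sub>i |s\<^sub>i|\<^sup>2 J s\<^sub>i\<close>.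
  If all sides but \<open>s\<^sub>n\<close> have length \<open>l\<close>, then \<open>\<Sum>\<^sub>i s\<^sub>i = 0\<close> turns the right-hand side into
  \<open>(|s\<^sub>n|\<^sup>2 - l\<^sup>2) J s\<^sub>n\<close>, which is orthogonal to \<open>s\<^sub>n\<close>.

  Every symmetry of \<open>P\<close> with a fixed point also fixes \<open>CM(P)\<close> and \<open>CCM(P)\<close>: \<open>A(P)\<close> and the sums
  defining both points all pick up the same sign from the orientation. The fixed points of a
  reflection are its axis, and a nontrivial rotation fixes only its center.
\<close>

subsection \<open>Cyclic sums\<close>

definition cyclic_sum :: "(real^2 \<Rightarrow> real^2 \<Rightarrow> 'a::real_vector) \<Rightarrow> (real^2) list \<Rightarrow> 'a" where
  "cyclic_sum F P = (\<Sum>i<length P. F (vtx P i) (vtx P (Suc i)))"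

lemma vtx_add_length [simp]: "vtx P (i + length P) = vtx P i" "vtx P (length P + i) = vtx P i"
  by (simp_all add: vtx_def)

lemma vtx_map: "P \<noteq> [] \<Longrightarrow> vtx (map f P) i = f (vtx P i)"
  by (simp add: vtx_def)

lemma vtx_rotate: "P \<noteq> [] \<Longrightarrow> vtx (rotate k P) i = vtx P (i + k)"
  by (simp add: vtx_def nth_rotate mod_add_right_eq add.commute)

text \<open>The index is \<open>length P - 1 - i\<close> plus one period, so that natural
  subtraction does not truncate even at \<open>i = length P\<close>, the value that
  \<open>Suc i\<close> takes at the last side.\<close>

lemma vtx_rev:
  assumes "i \<le> length P" "P \<noteq> []"
  shows "vtx (rev P) i = vtx P (2 * length P - Suc i)"
proof (cases "i = length P")
  case True
  then have "2 * length P - Suc i = length P - 1" by simp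
  with True assms show ?thesis by (simp add: vtx_def rev_nth)
next
  case False
  then have "2 * length P - Suc i = (length P - Suc i) + length P" using assms by simp
  then have "vtx P (2 * length P - Suc i) = vtx P (length P - Suc i)" by (simp only: vtx_add_length)
  with False assms show ?thesis by (simp add: vtx_def rev_nth)
qed

text \<open>Raising the shift from \<open>k\<close> to \<open>Suc k\<close> changes the sum by
  \<open>G (n + k) - G k\<close>, which vanishes by periodicity.\<close>

lemma sum_periodic_shift:
  fixes G :: "nat \<Rightarrow> 'a::ab_group_add"
  assumes "\<And>i. G (i + n) = G i"
  shows "(\<Sum>i<n. G (i + k)) = (\<Sum>i<n. G i)"
proof (induction k)
  case (Suc k)
  have "(\<Sum>i<n. G (Suc i + k) - G (i + k)) = 0"
    using sum_lessThan_telescope[of "\<lambda>i. G (i + k)" n] assms[of k] by (simp add: add.commute)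
  with Suc show ?case by (simp add: sum_subtractf)
qed simp

lemma cyclic_sum_rotate: "cyclic_sum F (rotate k P) = cyclic_sum F P"
proof (cases "P = []")
  case False
  then show ?thesis
    using sum_periodic_shift[of "\<lambda>i. F (vtx P i) (vtx P (Suc i))" "length P" k]
    by (simp add: cyclic_sum_def vtx_rotate flip: add_Suc)
qed (simp add: cyclic_sum_def)

lemma cyclic_sum_rev: "cyclic_sum F (rev P) = cyclic_sum (\<lambda>v w. F w v) P"
proof (cases "P = []")
  case False
  define n where "n = length P"
  define H where "H = (\<lambda>i. F (vtx P (Suc i)) (vtx P i))"
  have "n > 0" using False by (simp add: n_def)
  have per: "H (i + n) = H i" for i
    by (simp add: H_def n_def flip: add_Suc)
  \<comment> \<open>Each side of the reversed list is a side of \<open>P\<close> traversed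
    backwards. Its index is split into the reflection \<open>n - Suc i\<close> and a shift by
    \<open>n - 1\<close>, both of which preserve the sum.\<close>
  have "cyclic_sum F (rev P) = (\<Sum>i<n. H ((n - Suc i) + (n - 1)))"
    unfolding cyclic_sum_def length_rev n_def[symmetric]
  proof (rule sum.cong)
    fix i assume "i \<in> {..<n}"
    then have "Suc ((n - Suc i) + (n - 1)) = 2 * n - Suc i"
      "(n - Suc i) + (n - 1) = 2 * n - Suc (Suc i)" by auto
    with \<open>i \<in> _\<close> False show "F (vtx (rev P) i) (vtx (rev P) (Suc i)) = H ((n - Suc i) + (n - 1))"
      unfolding H_def n_def by (simp add: vtx_rev)
  qed simp
  also have "\<dots> = (\<Sum>i<n. H (i + (n - 1)))"
    by (rule sum.nat_diff_reindex)
  also have "\<dots> = (\<Sum>i<n. H i)"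
    by (rule sum_periodic_shift) (rule per)
  finally show ?thesis by (simp add: cyclic_sum_def H_def n_def)
qed (simp add: cyclic_sum_def)

lemma cyclic_sum_map: "cyclic_sum F (map f P) = cyclic_sum (\<lambda>v w. F (f v) (f w)) P"
  by (cases "P = []") (simp_all add: cyclic_sum_def vtx_map)

lemma cyclic_sum_linear:
  "linear g \<Longrightarrow> cyclic_sum (\<lambda>v w. g (F v w)) P = g (cyclic_sum F P)"
  by (simp add: cyclic_sum_def linear_sum)

lemma cyclic_sum_modulo_telescope:
  assumes "\<And>v w. F v w = G v w + (h w - h v)"
  shows "cyclic_sum F P = cyclic_sum G P"
  by (simp add: cyclic_sum_def assms sum.distrib sum_cyclic_telescope)

text \<open>The sign \<open>e\<close> is 1 for a cyclic shift and -1 for a reversal, which swaps the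
  arguments of every skew summand. Real and vector summands are treated together because the area
  and both centers must share one \<open>e\<close>.\<close>

lemma polygon_symmetry_cyclic_sum:
  assumes "polygon_symmetry f P"
  obtains e :: real where
    "\<And>F::real^2 \<Rightarrow> real^2 \<Rightarrow> real. (\<And>v w. F w v = - F v w) \<Longrightarrow>
       cyclic_sum (\<lambda>v w. F (f v) (f w)) P = e *\<^sub>R cyclic_sum F P"
    "\<And>F::real^2 \<Rightarrow> real^2 \<Rightarrow> real^2. (\<And>v w. F w v = - F v w) \<Longrightarrow>
       cyclic_sum (\<lambda>v w. F (f v) (f w)) P = e *\<^sub>R cyclic_sum F P"
proof -
  obtain k where "map f P = rotate k P \<or> map f P = rotate k (rev P)"
    using assms by (auto simp: polygon_symmetry_def)
  then consider "map f P = rotate k P" | "map f P = rotate k (rev P)" by blast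
  then show ?thesis
  proof cases
    case 1
    have eq: "cyclic_sum (\<lambda>v w. F (f v) (f w)) P = 1 *\<^sub>R cyclic_sum F P"
      for F :: "real^2 \<Rightarrow> real^2 \<Rightarrow> 'b::real_vector"
      unfolding cyclic_sum_map[of F f P, symmetric] 1 cyclic_sum_rotate by simp
    show ?thesis by (rule that[of 1]; rule eq)
  next
    case 2
    have eq: "cyclic_sum (\<lambda>v w. F (f v) (f w)) P = (- 1) *\<^sub>R cyclic_sum F P"
      if "\<And>v w. F w v = - F v w" for F :: "real^2 \<Rightarrow> real^2 \<Rightarrow> 'b::real_vector"
    proof -
      have "cyclic_sum (\<lambda>v w. F (f v) (f w)) P = cyclic_sum (\<lambda>v w. F w v) P"
        unfolding cyclic_sum_map[of F f P, symmetric] 2 cyclic_sum_rotate cyclic_sum_rev ..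
      also have "\<dots> = (- 1) *\<^sub>R cyclic_sum F P"
        unfolding cyclic_sum_def scaleR_minus1_left sum_negf[symmetric]
        by (intro sum.cong refl that)
      finally show ?thesis .
    qed
    show ?thesis by (rule that[of "-1"]; rule eq; assumption)
  qed
qed

subsection \<open>Area and centers as cyclic sums\<close>

definition cross2 :: "real^2 \<Rightarrow> real^2 \<Rightarrow> real" where
  "cross2 v w = v$1 * w$2 - v$2 * w$1"

definition quarter_turn :: "real^2 \<Rightarrow> real^2" where
  "quarter_turn v = vector [- v$2, v$1]"

lemma linear_quarter_turn: "linear quarter_turn"
  by (intro linearI) (simp_all add: quarter_turn_def vec2_eq_iff)

lemma cross2_skew: "cross2 w v = - cross2 v w"
  by (simp add: cross2_def)

lemma inner_quarter_turn: "quarter_turn v \<bullet> w = cross2 v w"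
  by (simp add: quarter_turn_def cross2_def inner_vec_def sum_2)

lemma signed_area_cyclic_sum:
  "cyclic_sum (\<lambda>v w. cross2 (v - c) (w - c)) P = 2 * signed_area P"
proof -
  have "cyclic_sum (\<lambda>v w. cross2 (v - c) (w - c)) P = cyclic_sum cross2 P"
    by (rule cyclic_sum_modulo_telescope[where h = "\<lambda>v. cross2 v c"])
      (simp add: cross2_def algebra_simps)
  then show ?thesis
    by (simp add: cyclic_sum_def signed_area_def cross2_def mult.commute)
qed

lemma CM_cyclic_sum:
  assumes "signed_area P \<noteq> 0"
  shows "(6 * signed_area P) *\<^sub>R (CM P - c) =
    cyclic_sum (\<lambda>v w. cross2 (v - c) (w - c) *\<^sub>R ((v - c) + (w - c))) P"
proof -
  let ?A = "signed_area P"
  obtain z where "off_sides P z" using ex_off_sides by blast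
  \<comment> \<open>The formula \<open>CM_at_altdef\<close> holds for every base point, so
    \<open>c\<close> may lie on a side line, as a fixed point of a symmetry can.\<close>
  then have "CM P = CM_at P c" by (simp add: CM_eq CM_at_altdef)
  have T: "tri_area P c i = cross2 (vtx P i - c) (vtx P (Suc i) - c) / 2" for i
    by (simp add: tri_area_altdef cross2_def)
  have "(6 * ?A) *\<^sub>R CM P = (\<Sum>i<length P. (6 * tri_area P c i) *\<^sub>R centroid c (vtx P i) (vtx P (Suc i)))"
    unfolding \<open>CM P = CM_at P c\<close> CM_at_def scaleR_sum_right using assms by simp
  moreover have "(6 * ?A) *\<^sub>R c = (\<Sum>i<length P. (6 * tri_area P c i) *\<^sub>R c)"
    using signed_area_cyclic_sum[of c P] by (simp add: T cyclic_sum_def flip: scaleR_sum_left sum_distrib_left sum_divide_distrib)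
  ultimately have "(6 * ?A) *\<^sub>R (CM P - c) =
      (\<Sum>i<length P. (6 * tri_area P c i) *\<^sub>R (centroid c (vtx P i) (vtx P (Suc i)) - c))"
    by (simp add: scaleR_diff_right sum_subtractf)
  also have "\<dots> = cyclic_sum (\<lambda>v w. cross2 (v - c) (w - c) *\<^sub>R ((v - c) + (w - c))) P"
    unfolding cyclic_sum_def
    by (intro sum.cong refl) (simp add: T centroid_def vec2_eq_iff field_simps)
  finally show ?thesis .
qed

lemma CM_minus_CCM_cyclic_sum:
  assumes "polygon P" "signed_area P \<noteq> 0"
  shows "(12 * signed_area P) *\<^sub>R (CM P - CCM P) =
    cyclic_sum (\<lambda>v w. (norm (w - v))\<^sup>2 *\<^sub>R quarter_turn (w - v)) P"
proof -
  \<comment> \<open>With \<open>J\<close> the quarter turn, \<open>G v w\<close> is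
    \<open>|w|^2 J v - |v|^2 J w\<close>, the summand of \<open>CCM_at_altdef\<close>. The factors 3
    and 2 below come from 12 = 3 * 4 = 2 * 6.\<close>
  define G :: "real^2 \<Rightarrow> real^2 \<Rightarrow> real^2" where
    "G = (\<lambda>v w. vector [w$2 * (v$1^2 + v$2^2) - v$2 * (w$1^2 + w$2^2),
                         v$1 * (w$1^2 + w$2^2) - w$1 * (v$1^2 + v$2^2)])"
  obtain z where z: "off_sides P z" using ex_off_sides by blast
  have "CCM P = (1 / (4 * signed_area P)) *\<^sub>R cyclic_sum G P"
    unfolding CCM_eq[OF assms(1) z] CCM_at_altdef[OF assms(1) z]
    by (simp add: cyclic_sum_def G_def Let_def)
  then have CCM: "(12 * signed_area P) *\<^sub>R CCM P = 3 *\<^sub>R cyclic_sum G P"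
    using assms(2) by simp
  have CM: "(12 * signed_area P) *\<^sub>R CM P = 2 *\<^sub>R cyclic_sum (\<lambda>v w. cross2 v w *\<^sub>R (v + w)) P"
    using arg_cong[OF CM_cyclic_sum[OF assms(2), of 0], of "scaleR 2"] by simp
  have nsq: "(norm x)\<^sup>2 = (x$1)\<^sup>2 + (x$2)\<^sup>2" for x :: "real^2"
    by (simp add: norm_vec_def L2_set_def sum_2)
  have "cyclic_sum (\<lambda>v w. (norm (w - v))\<^sup>2 *\<^sub>R quarter_turn (w - v)) P =
      cyclic_sum (\<lambda>v w. 2 *\<^sub>R (cross2 v w *\<^sub>R (v + w)) - 3 *\<^sub>R G v w) P"
    \<comment> \<open>Expanding the left summand gives \<open>|w|^2 J w - |v|^2 J v\<close>, which
      telescopes, and mixed terms, which form the right summand.\<close>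
    by (rule cyclic_sum_modulo_telescope[where h = "\<lambda>v. (norm v)\<^sup>2 *\<^sub>R quarter_turn v"])
      (simp only: vec2_eq_iff nsq, simp add: quarter_turn_def cross2_def G_def power2_eq_square algebra_simps)
  also have "\<dots> = 2 *\<^sub>R cyclic_sum (\<lambda>v w. cross2 v w *\<^sub>R (v + w)) P - 3 *\<^sub>R cyclic_sum G P"
    by (simp add: cyclic_sum_def sum_subtractf scaleR_sum_right)
  finally show ?thesis by (simp add: scaleR_diff_right CM CCM)
qed

subsection \<open>Symmetries fix both centers\<close>

text \<open>Here \<open>d\<close> is the determinant of \<open>g\<close>. The law for
  \<open>quarter_turn\<close> is dual to the one for \<open>cross2\<close>: both sides are tested
  against vectors \<open>g w\<close>, which exhaust the plane, and \<open>g\<close> preserves inner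
  products.\<close>

lemma cross2_orthogonal_transformation:
  fixes g :: "real^2 \<Rightarrow> real^2"
  assumes "orthogonal_transformation g"
  obtains d where "d \<noteq> 0" "\<And>v w. cross2 (g v) (g w) = d * cross2 v w"
    "\<And>v. quarter_turn (g v) = d *\<^sub>R g (quarter_turn v)"
proof -
  define d where "d = det (matrix g)"
  have lin: "linear g" using assms by (rule orthogonal_transformation_linear)
  have "d \<noteq> 0"
    using orthogonal_transformation_det[OF assms] by (auto simp: d_def)
  moreover have cross: "cross2 (g v) (g w) = d * cross2 v w" for v w
  proof -
    have "g x = matrix g *v x" for x using lin by (simp add: matrix_works)
    then show ?thesis
      by (simp add: d_def det_2 cross2_def matrix_vector_mult_def sum_2 algebra_simps)
  qed
  moreover have "quarter_turn (g v) = d *\<^sub>R g (quarter_turn v)" for v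
  proof (rule vector_eq_ldot[THEN iffD1, rule_format])
    fix x
    obtain w where w: "x = g w" using orthogonal_transformation_surj[OF assms] by blast
    show "x \<bullet> quarter_turn (g v) = x \<bullet> (d *\<^sub>R g (quarter_turn v))"
      using assms unfolding w
      by (simp add: inner_quarter_turn cross orthogonal_transformation_def inner_commute[of "g w"]
          inner_commute[of w])
  qed
  ultimately show ?thesis using that by blast
qed

lemma polygon_symmetry_fixes_centers:
  assumes P: "polygon P" "signed_area P \<noteq> 0"
    and sym: "polygon_symmetry f P" and c: "f c = c"
  shows "f (CM P) = CM P" "f (CCM P) = CCM P"
proof -
  \<comment> \<open>Taking the fixed point \<open>c\<close> as origin turns the isometry into a
    linear map.\<close>
  define g where "g y = f (c + y) - c" for y
  have "orthogonal_transformation g"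
    using sym c unfolding orthogonal_transformation_isometry polygon_symmetry_def
    by (simp add: g_def dist_norm algebra_simps)
  then have lin: "linear g" and norm_g: "norm (g y) = norm y" for y
    by (simp_all add: orthogonal_transformation)
  have f: "f x = c + g (x - c)" for x by (simp add: g_def)
  have fd: "f w - f v = g (w - v)" for v w
    using linear_diff[OF lin, of "w - c" "v - c"] by (simp add: f)
  obtain d where "d \<noteq> 0" and cross: "\<And>v w. cross2 (g v) (g w) = d * cross2 v w"
    and turn: "\<And>v. quarter_turn (g v) = d *\<^sub>R g (quarter_turn v)"
    using cross2_orthogonal_transformation[OF \<open>orthogonal_transformation g\<close>] by blast
  obtain e where
    e1: "\<And>F::real^2 \<Rightarrow> real^2 \<Rightarrow> real. (\<And>v w. F w v = - F v w) \<Longrightarrow>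
       cyclic_sum (\<lambda>v w. F (f v) (f w)) P = e *\<^sub>R cyclic_sum F P" and
    e2: "\<And>F::real^2 \<Rightarrow> real^2 \<Rightarrow> real^2. (\<And>v w. F w v = - F v w) \<Longrightarrow>
       cyclic_sum (\<lambda>v w. F (f v) (f w)) P = e *\<^sub>R cyclic_sum F P"
    using polygon_symmetry_cyclic_sum[OF sym] by blast
  \<comment> \<open>Since the area is nonzero, the sign from the vertex order must equal the
    determinant.\<close>
  have "d * (2 * signed_area P) = e * (2 * signed_area P)"
    using e1[of "\<lambda>v w. cross2 (v - c) (w - c)", OF cross2_skew]
      cyclic_sum_linear[of "\<lambda>x. d * x" "\<lambda>v w. cross2 (v - c) (w - c)" P]
    by (simp add: f cross signed_area_cyclic_sum linear_iff algebra_simps)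
  then have [simp]: "e = d" using P by simp
  \<comment> \<open>Applying \<open>f\<close> to the vertices multiplies the sum by
    \<open>e = d\<close> and also acts on it as \<open>d\<close> times \<open>g\<close>; cancelling
    \<open>d\<close> leaves a fixed vector.\<close>
  have fixed: "g (cyclic_sum F P) = cyclic_sum F P"
    if skew: "\<And>v w. F w v = - F v w" and "\<And>v w. F (f v) (f w) = d *\<^sub>R g (F v w)" for F
  proof -
    have "linear (\<lambda>x. d *\<^sub>R g x)" using lin by (simp add: linear_compose_scale_right)
    then have "d *\<^sub>R g (cyclic_sum F P) = d *\<^sub>R cyclic_sum F P"
      using e2[of F, OF skew] that(2) cyclic_sum_linear[of "\<lambda>x. d *\<^sub>R g x" F P] by simp
    then show ?thesis using \<open>d \<noteq> 0\<close> by simp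
  qed
  have "g ((6 * signed_area P) *\<^sub>R (CM P - c)) = (6 * signed_area P) *\<^sub>R (CM P - c)"
    unfolding CM_cyclic_sum[OF P(2)]
  proof (rule fixed)
    show "cross2 (w - c) (v - c) *\<^sub>R (w - c + (v - c)) = - (cross2 (v - c) (w - c) *\<^sub>R (v - c + (w - c)))" for v w
      using cross2_skew[of "w - c" "v - c"] by (simp add: add.commute)
  qed (simp add: f cross linear_scale[OF lin] flip: linear_add[OF lin])
  then have "g (CM P - c) = CM P - c"
    using P by (simp add: linear_scale[OF lin])
  then show CM: "f (CM P) = CM P" by (simp add: f)
  have "g ((12 * signed_area P) *\<^sub>R (CM P - CCM P)) = (12 * signed_area P) *\<^sub>R (CM P - CCM P)"
    unfolding CM_minus_CCM_cyclic_sum[OF P]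
  proof (rule fixed)
    show "(norm (v - w))\<^sup>2 *\<^sub>R quarter_turn (v - w) = - ((norm (w - v))\<^sup>2 *\<^sub>R quarter_turn (w - v))" for v w
      using linear_neg[OF linear_quarter_turn, of "w - v"] by (simp add: norm_minus_commute)
  qed (simp add: fd turn norm_g linear_scale[OF lin])
  then have "g (CM P - CCM P) = CM P - CCM P"
    using P by (simp add: linear_scale[OF lin])
  then show "f (CCM P) = CCM P" using fd[of "CM P" "CCM P"] CM by simp
qed

lemma rotation_matrix_fixed_vector:
  fixes R :: "real^2^2"
  assumes "rotation_matrix R" "R *v y = y" "y \<noteq> 0"
  shows "R = mat 1"
proof -
  let ?a = "R$1$1" and ?b = "R$1$2" and ?c = "R$2$1" and ?d = "R$2$2"
  have "transpose R ** R = mat 1" and "det R = 1"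
    using assms(1) by (simp_all add: rotation_matrix_def orthogonal_matrix)
  then have o: "?a * ?a + ?c * ?c = 1" "?a * ?b + ?c * ?d = 0" "?b * ?b + ?d * ?d = 1"
    and det: "?a * ?d - ?b * ?c = 1"
    by (simp_all add: vec_eq_iff forall_2 matrix_matrix_mult_def transpose_def mat_def sum_2 det_2
        algebra_simps)
  have fixed: "?a * y$1 + ?b * y$2 = y$1" "?c * y$1 + ?d * y$2 = y$2"
    using assms(2) by (simp_all add: vec_eq_iff forall_2 matrix_vector_mult_def sum_2)
  \<comment> \<open>The transpose of \<open>R\<close> is its inverse and hence, the determinant
    being 1, its adjugate; these are the entries compared.\<close>
  have da: "?d = ?a" and bc: "?b = - ?c"
    using o det by algebra+
  \<comment> \<open>The transpose of \<open>R - 1\<close> is applied to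
    \<open>(R - 1) y = 0\<close>; the product of the two matrices is a scalar matrix.\<close>
  have "((?a - 1)\<^sup>2 + ?c\<^sup>2) * y$1 =
      (?a - 1) * (?a * y$1 + ?b * y$2 - y$1) + ?c * (?c * y$1 + ?d * y$2 - y$2)"
    "((?a - 1)\<^sup>2 + ?c\<^sup>2) * y$2 =
      (?a - 1) * (?c * y$1 + ?d * y$2 - y$2) - ?c * (?a * y$1 + ?b * y$2 - y$1)"
    unfolding da bc by (simp_all add: power2_eq_square algebra_simps)
  then have "((?a - 1)\<^sup>2 + ?c\<^sup>2) * y$1 = 0" "((?a - 1)\<^sup>2 + ?c\<^sup>2) * y$2 = 0"
    unfolding fixed by simp_all
  then have "(?a - 1)\<^sup>2 + ?c\<^sup>2 = 0"
    using assms(3) by (auto simp: vec2_eq_iff)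
  then have "?a = 1" "?c = 0" by (simp_all add: sum_power2_eq_zero_iff)
  with da bc show ?thesis by (simp add: vec_eq_iff forall_2 mat_def)
qed

subsection \<open>The generalized Euler line\<close>

lemma euler_line_eq_affine_hull: "euler_line P = affine hull {CM P, CCM P}"
proof -
  have "u + v = 1 \<longleftrightarrow> v = 1 - u" for u v :: real by auto
  then show ?thesis by (simp add: euler_line_def affine_hull_2)
qed

lemma euler_line_eq_point: "CM P = CCM P \<Longrightarrow> euler_line P = {CM P}"
  by (simp add: euler_line_eq_affine_hull)

lemma euler_line_reflection:
  assumes "polygon P" "signed_area P \<noteq> 0" "reflection_line P L"
  shows "euler_line P = L \<or> (\<exists>p\<in>L. euler_line P = {p})"
proof -
  have L: "affine L" "aff_dim L = 1" and sym: "polygon_symmetry (reflection_across L) P"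
    using assms(3) by (auto simp: reflection_line_def)
  have "L \<noteq> {}" using L(2) by auto
  then obtain c where "c \<in> L" by blast
  then have "reflection_across L c = c"
    by (simp add: reflection_across_def closest_point_self scaleR_2)
  note fixed = polygon_symmetry_fixes_centers[OF assms(1,2) sym this]
  \<comment> \<open>A fixed point equals its projection, which lies in \<open>L\<close> because a
    nonempty affine set is closed.\<close>
  have axis: "x \<in> L" if "reflection_across L x = x" for x
  proof -
    have "2 *\<^sub>R closest_point L x = 2 *\<^sub>R x"
      using that by (simp add: reflection_across_def scaleR_2 algebra_simps)
    then show ?thesis
      using closest_point_in_set[of L x] \<open>L \<noteq> {}\<close> closed_affine_hull[of L] L(1)
      by (simp add: affine_hull_eq[THEN iffD2])
  qed
  show ?thesis
  proof (cases "CM P = CCM P")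
    case True
    then show ?thesis using euler_line_eq_point axis fixed by blast
  next
    case False
    \<comment> \<open>Nested nonempty affine sets of equal dimension coincide.\<close>
    have "euler_line P \<subseteq> L"
      unfolding euler_line_eq_affine_hull using axis fixed L(1) by (simp add: hull_minimal)
    moreover have "aff_dim (euler_line P) = aff_dim L"
      using False L(2) by (simp add: euler_line_eq_affine_hull aff_dim_2)
    moreover have "affine (euler_line P)" "euler_line P \<noteq> {}"
      by (simp_all add: euler_line_eq_affine_hull)
    ultimately show ?thesis using affine_dim_equal L(1) by blast
  qed
qed

lemma euler_line_rotation:
  assumes "polygon P" "signed_area P \<noteq> 0" "rotation_center P C"
  shows "euler_line P = {C}"
proof -
  obtain R where R: "rotation_matrix R" "R \<noteq> mat 1"
    and sym: "polygon_symmetry (rotation_about C R) P"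
    using assms(3) by (auto simp: rotation_center_def)
  have "rotation_about C R C = C" by (simp add: rotation_about_def)
  note fixed = polygon_symmetry_fixes_centers[OF assms(1,2) sym this]
  have "x = C" if "rotation_about C R x = x" for x
  proof -
    have "R *v (x - C) = x - C" using that by (simp add: rotation_about_def algebra_simps)
    then show ?thesis using rotation_matrix_fixed_vector[OF R(1)] R(2) by (metis right_minus_eq)
  qed
  then show ?thesis using fixed euler_line_eq_point by metis
qed

lemma euler_line_orthogonal_last_side:
  assumes "polygon P" "signed_area P \<noteq> 0"
    and eq: "\<And>i j. i < length P - 1 \<Longrightarrow> j < length P - 1 \<Longrightarrow> norm (side P i) = norm (side P j)"
  shows "orthogonal (CM P - CCM P) (side P (length P - 1))"
proof -
  obtain m where m: "length P = Suc m" "m > 0"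
    using assms(1) by (cases "length P") (auto simp: polygon_def)
  let ?l = "(norm (side P 0))\<^sup>2" and ?s = "side P m"
  have "(\<Sum>i<length P. side P i) = 0"
    using sum_cyclic_telescope[of "\<lambda>x. x" P] by (simp add: side_def)
  then have closed: "(\<Sum>i<m. side P i) = - ?s" by (simp add: m eq_neg_iff_add_eq_0)
  have "(12 * signed_area P) *\<^sub>R (CM P - CCM P) =
      (\<Sum>i<length P. (norm (side P i))\<^sup>2 *\<^sub>R quarter_turn (side P i))"
    unfolding CM_minus_CCM_cyclic_sum[OF assms(1,2)] cyclic_sum_def side_def ..
  also have "\<dots> = (\<Sum>i<m. ?l *\<^sub>R quarter_turn (side P i)) + (norm ?s)\<^sup>2 *\<^sub>R quarter_turn ?s"
  proof -
    have "norm (side P i) = norm (side P 0)" if "i < m" for i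
      using eq[of i 0] that m by simp
    then have "(\<Sum>i<m. (norm (side P i))\<^sup>2 *\<^sub>R quarter_turn (side P i)) =
        (\<Sum>i<m. ?l *\<^sub>R quarter_turn (side P i))"
      by (intro sum.cong refl) (metis lessThan_iff)
    then show ?thesis unfolding m by simp
  qed
  also have "(\<Sum>i<m. ?l *\<^sub>R quarter_turn (side P i)) = - ?l *\<^sub>R quarter_turn ?s"
    by (simp add: closed linear_neg[OF linear_quarter_turn]
        flip: scaleR_sum_right linear_sum[OF linear_quarter_turn])
  \<comment> \<open>Only multiples of \<open>quarter_turn ?s\<close> remain, and their inner product
    with \<open>?s\<close> is a multiple of \<open>cross2 ?s ?s = 0\<close>.\<close>
  finally have "((12 * signed_area P) *\<^sub>R (CM P - CCM P)) \<bullet> ?s = 0"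
    by (simp add: inner_add_left inner_diff_left inner_quarter_turn cross2_def mult.commute)
  then show ?thesis using assms(2) m by (simp add: orthogonal_def)
qed

theorem theorem5:
  fixes P :: "(real^2) list"
  assumes "polygon P" and "signed_area P \<noteq> 0"
  shows "(\<forall>L. reflection_line P L \<longrightarrow>
            euler_line P = L \<or> (\<exists>p\<in>L. euler_line P = {p})) \<and>
         (\<forall>C. rotation_center P C \<and> off_sides P C \<longrightarrow> euler_line P = {C}) \<and>
         ((\<forall>i < length P - 1. \<forall>j < length P - 1. norm (side P i) = norm (side P j)) \<longrightarrow>
            orthogonal (CM P - CCM P) (side P (length P - 1)))"
  using euler_line_reflection[OF assms] euler_line_rotation[OF assms]
    euler_line_orthogonal_last_side[OF assms] by blast

end
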